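(* Let $S$ be a set, $\mathscr H$ a vector subspace of the space of all functions $S\to\mathbb R$, $\phi$ a linear functional on $\mathscr H$, and let $V\subset S$ be $\mathscr H$-bounded, i.e. such that $\sup_{v\in V}|h(v)|<\infty$ for all $h\in\mathscr H$. Then $$\phi(h)\ge\inf_{v\in V}h(v)\qquad\text{for all }h\in\mathscr H$$ if and only if there exists a probability structure $(\mathscr R,\mu)$ on $V$ such that, for all $h\in\mathscr H$, (the restriction to $V$ of) $h$ belongs to $L^1(\mu)$ and $$\phi(h)=\int_Vh(v)\,d\mu(v).$$
   Context: Finitely additive integration. A measure structure on a set $\Omega$ is a pair $(\mathscr A,\lambda)$ with $\mathscr A$ a ring of subsets of $\Omega$ and $\lambda:\mathscr A\to[0,\infty)$ finitely additive. $\mathscr S(\mathscr A)$ is the linear span of the indicators of members of $\mathscr A$, with the obvious integral. For $E\subset\Omega$, $\lambda^*(E)=\inf\{\lambda(A):A\in\mathscr A, E\subset A\}$ (with $\inf\varnothing=\infty$). $X_n$ $\lambda$-converges to $X$ if $\lim_n\lambda^*(|X_n-X|>c)=0$ for every $c>0$. $X\in L^1(\lambda)$ if there is a sequence $X_n\in\mathscr S(\mathscr A)$ that $\lambda$-converges to $X$ and is Cauchy in the sense $\int|X_n-X_m|d\lambda\to0$; then $\int X\,d\lambda=\lim_n\int X_n\,d\lambda$. A measure structure is a probability structure if $\sup_{A\in\mathscr A}\lambda(A)=1$. *)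

theory Defs
  imports "HOL-Analysis.Analysis"
begin

definition function_subspace :: "'s set \<Rightarrow> ('s \<Rightarrow> real) set \<Rightarrow> bool" where
  "function_subspace S H \<longleftrightarrow>
     H \<subseteq> (S \<rightarrow>\<^sub>E UNIV) \<and>
     (\<lambda>x\<in>S. 0) \<in> H \<and>
     (\<forall>f\<in>H. \<forall>g\<in>H. (\<lambda>x\<in>S. f x + g x) \<in> H) \<and>
     (\<forall>c. \<forall>f\<in>H. (\<lambda>x\<in>S. c * f x) \<in> H)"

definition linear_functional_on ::
    "'s set \<Rightarrow> ('s \<Rightarrow> real) set \<Rightarrow> (('s \<Rightarrow> real) \<Rightarrow> real) \<Rightarrow> bool" where
  "linear_functional_on S H \<phi> \<longleftrightarrow>
     (\<forall>f\<in>H. \<forall>g\<in>H. \<phi> (\<lambda>x\<in>S. f x + g x) = \<phi> f + \<phi> g) \<and>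
     (\<forall>c. \<forall>f\<in>H. \<phi> (\<lambda>x\<in>S. c * f x) = c * \<phi> f)"

definition bounded_on_family :: "('s \<Rightarrow> real) set \<Rightarrow> 's set \<Rightarrow> bool" where
  "bounded_on_family H V \<longleftrightarrow> (\<forall>h\<in>H. (SUP v\<in>V. ereal \<bar>h v\<bar>) < \<infinity>)"

text \<open>
  Set functions and integrands are total functions; only the values of a set function on the ring
  \<open>\<A>\<close> and the values of an integrand on \<open>\<Omega>\<close> are ever used.
\<close>

definition measure_structure :: "'a set \<Rightarrow> 'a set set \<Rightarrow> ('a set \<Rightarrow> real) \<Rightarrow> bool" where
  "measure_structure \<Omega> \<A> \<mu> \<longleftrightarrow>
     ring_of_sets \<Omega> \<A> \<and> (\<forall>A\<in>\<A>. 0 \<le> \<mu> A) \<and> additive \<A> \<mu>"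

text \<open>The supremum is taken in the extended reals, so that unbounded \<open>\<mu>\<close> is excluded.\<close>

definition probability_structure :: "'a set \<Rightarrow> 'a set set \<Rightarrow> ('a set \<Rightarrow> real) \<Rightarrow> bool" where
  "probability_structure \<Omega> \<A> \<mu> \<longleftrightarrow>
     measure_structure \<Omega> \<A> \<mu> \<and> (SUP A\<in>\<A>. ereal (\<mu> A)) = 1"

definition simple_functions :: "'a set set \<Rightarrow> ('a \<Rightarrow> real) set" where
  "simple_functions \<A> =
     {(\<lambda>x. \<Sum>A\<in>F. c A * indicator A x) | F c. finite F \<and> F \<subseteq> \<A>}"

text \<open>
  For \<open>X\<close> in \<open>simple_functions \<A>\<close> the level sets of nonzero values belong to \<open>\<A>\<close>, and
  the sum below equals \<open>\<Sum>A\<in>F. c A * \<mu> A\<close> for every representation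
  \<open>X = (\<lambda>x. \<Sum>A\<in>F. c A * indicator A x)\<close>. The value 0 is left out because its
  level set need not be in the ring.
\<close>

definition simple_integral_fa :: "'a set \<Rightarrow> ('a set \<Rightarrow> real) \<Rightarrow> ('a \<Rightarrow> real) \<Rightarrow> real" where
  "simple_integral_fa \<Omega> \<mu> X = (\<Sum>y\<in>X ` \<Omega> - {0}. y * \<mu> {x\<in>\<Omega>. X x = y})"

definition outer_value :: "'a set set \<Rightarrow> ('a set \<Rightarrow> real) \<Rightarrow> 'a set \<Rightarrow> ereal" where
  "outer_value \<A> \<mu> E = (INF A\<in>{A\<in>\<A>. E \<subseteq> A}. ereal (\<mu> A))"

definition converges_fa ::
    "'a set \<Rightarrow> 'a set set \<Rightarrow> ('a set \<Rightarrow> real) \<Rightarrow> (nat \<Rightarrow> 'a \<Rightarrow> real) \<Rightarrow> ('a \<Rightarrow> real) \<Rightarrow> bool" where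
  "converges_fa \<Omega> \<A> \<mu> Xs X \<longleftrightarrow>
     (\<forall>c>0. (\<lambda>n. outer_value \<A> \<mu> {x\<in>\<Omega>. \<bar>Xs n x - X x\<bar> > c}) \<longlonglongrightarrow> 0)"

definition approximates_fa ::
    "'a set \<Rightarrow> 'a set set \<Rightarrow> ('a set \<Rightarrow> real) \<Rightarrow> (nat \<Rightarrow> 'a \<Rightarrow> real) \<Rightarrow> ('a \<Rightarrow> real) \<Rightarrow> bool" where
  "approximates_fa \<Omega> \<A> \<mu> Xs X \<longleftrightarrow>
     (\<forall>n. Xs n \<in> simple_functions \<A>) \<and>
     converges_fa \<Omega> \<A> \<mu> Xs X \<and>
     (\<forall>e>0. \<exists>N. \<forall>m\<ge>N. \<forall>n\<ge>N. simple_integral_fa \<Omega> \<mu> (\<lambda>x. \<bar>Xs n x - Xs m x\<bar>) < e)"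

definition L1_fa :: "'a set \<Rightarrow> 'a set set \<Rightarrow> ('a set \<Rightarrow> real) \<Rightarrow> ('a \<Rightarrow> real) set" where
  "L1_fa \<Omega> \<A> \<mu> = {X. \<exists>Xs. approximates_fa \<Omega> \<A> \<mu> Xs X}"

text \<open>On \<open>L1_fa \<Omega> \<A> \<mu>\<close> the limit exists and does not depend on the approximating sequence.\<close>

definition integral_fa ::
    "'a set \<Rightarrow> 'a set set \<Rightarrow> ('a set \<Rightarrow> real) \<Rightarrow> ('a \<Rightarrow> real) \<Rightarrow> real" where
  "integral_fa \<Omega> \<A> \<mu> X =
     (THE r. \<exists>Xs. approximates_fa \<Omega> \<A> \<mu> Xs X \<and> (\<lambda>n. simple_integral_fa \<Omega> \<mu> (Xs n)) \<longlonglongrightarrow> r)"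

end

theory Submission
  imports Defs
begin

text \<open>
  If \<open>\<phi>\<close> is an integral and \<open>h \<ge> a\<close> on \<open>V\<close>, then a late member of a sequence of simple
  functions approximating \<open>h\<close> is at least \<open>a - \<epsilon>\<close> off a set of small measure, and the Cauchy
  property in mean makes its integral over that set small; hence
  \<open>\<phi> h \<ge> a\<close>. Applied to differences of approximating sequences, the same bound shows that the
  integral is well defined. Conversely, \<open>\<phi> h \<ge> inf h\<close> means that \<open>\<phi>\<close> is dominated by the
  supremum over \<open>V\<close>, so by a Hahn--Banach argument it extends to a positive normalized functional
  \<open>l\<close> on all functions bounded on \<open>V\<close>. Then \<open>\<mu> A = l (indicator A)\<close> on the power set of \<open>V\<close> represents
  \<open>\<phi>\<close>, since bounded functions are uniform limits of simple ones.
\<close>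

section \<open>Finitely additive integration\<close>

locale finitely_additive = ring_of_sets +
  fixes \<mu> :: "'a set \<Rightarrow> real"
  assumes nonneg: "A \<in> M \<Longrightarrow> 0 \<le> \<mu> A"
    and additive: "additive M \<mu>"
begin

lemma measure_empty: "\<mu> {} = 0"
  using additive by (auto simp: additive_def dest!: bspec[where x = "{}"])

lemma finite_UN_eq_sum:
  assumes "finite J" "disjoint_family_on B J" "\<And>j. j \<in> J \<Longrightarrow> B j \<in> M"
  shows "\<mu> (\<Union>j\<in>J. B j) = (\<Sum>j\<in>J. \<mu> (B j))"
  using assms
proof induction
  case empty
  show ?case by (simp add: measure_empty)
next
  case (insert i J)
  have "B i \<inter> (\<Union>j\<in>J. B j) = {}" "disjoint_family_on B J"
    using insert.hyps insert.prems(1) by (auto simp: disjoint_family_on_def)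
  moreover have "(\<Union>j\<in>J. B j) \<in> M" "B i \<in> M" using insert by auto
  ultimately show ?case
    using insert additive by (simp add: additive_def)
qed

lemma mono: "\<mu> A \<le> \<mu> B" if "A \<in> M" "B \<in> M" "A \<subseteq> B"
proof -
  have "\<mu> (A \<union> (B - A)) = \<mu> A + \<mu> (B - A)"
    using that additive unfolding additive_def by blast
  moreover have "A \<union> (B - A) = B" using that by blast
  ultimately show ?thesis using nonneg[of "B - A"] that by auto
qed

lemma Un_le: "\<mu> (A \<union> B) \<le> \<mu> A + \<mu> B" if "A \<in> M" "B \<in> M"
proof -
  have "\<mu> (A \<union> (B - A)) = \<mu> A + \<mu> (B - A)"
    using that additive unfolding additive_def by blast
  moreover have "A \<union> (B - A) = A \<union> B" by blast
  moreover have "\<mu> (B - A) \<le> \<mu> B" using that by (intro mono) auto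
  ultimately show ?thesis by simp
qed

section \<open>Simple functions and their integral\<close>

text \<open>An intrinsic form of the span of the indicators, shown to agree with it in
  \<open>simple_functions_eq\<close>. Level sets match the definition of the integral; the level set
  of 0 is exempt because a ring need not contain complements.\<close>

definition simple :: "('a \<Rightarrow> real) \<Rightarrow> bool" where
  "simple f \<longleftrightarrow> finite (f ` \<Omega>) \<and> (\<forall>x. x \<notin> \<Omega> \<longrightarrow> f x = 0) \<and> (\<forall>y. y \<noteq> 0 \<longrightarrow> {x\<in>\<Omega>. f x = y} \<in> M)"

abbreviation integral :: "('a \<Rightarrow> real) \<Rightarrow> real" where
  "integral \<equiv> simple_integral_fa \<Omega> \<mu>"

text \<open>The cells may be finer than the level sets, as \<open>d\<close> may repeat values: for y
  \<noteq> 0 the level set is the union of the cells with \<open>d j = y\<close>, and additivity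
  turns the integral into a sum over cells grouped by value.\<close>

lemma partition:
  assumes J: "finite J" and disj: "disjoint_family_on B J" and B: "\<And>j. j \<in> J \<Longrightarrow> B j \<in> M"
    and d: "\<And>j x. j \<in> J \<Longrightarrow> x \<in> B j \<Longrightarrow> f x = d j"
    and zero: "\<And>x. (\<And>j. j \<in> J \<Longrightarrow> x \<notin> B j) \<Longrightarrow> f x = 0"
  shows simple_partition: "simple f"
    and integral_partition: "integral f = (\<Sum>j\<in>J. d j * \<mu> (B j))"
proof -
  have level: "{x\<in>\<Omega>. f x = y} = (\<Union>j\<in>{j\<in>J. d j = y}. B j)" if "y \<noteq> 0" for y
  proof (intro set_eqI iffI)
    fix x assume "x \<in> {x\<in>\<Omega>. f x = y}"
    then have "f x \<noteq> 0" "f x = y" using that by auto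
    then obtain j where "j \<in> J" "x \<in> B j" using zero[of x] by auto
    then show "x \<in> (\<Union>j\<in>{j\<in>J. d j = y}. B j)" using d \<open>f x = y\<close> by auto
  next
    fix x assume "x \<in> (\<Union>j\<in>{j\<in>J. d j = y}. B j)"
    then obtain j where "j \<in> J" "x \<in> B j" "d j = y" by auto
    then show "x \<in> {x\<in>\<Omega>. f x = y}" using d B sets_into_space[of "B j"] by auto
  qed
  have fin: "f ` \<Omega> \<subseteq> insert 0 (d ` J)"
  proof (rule image_subsetI)
    fix x
    show "f x \<in> insert 0 (d ` J)"
      using d[of _ x] zero[of x] by (cases "\<exists>j\<in>J. x \<in> B j") auto
  qed
  show "simple f"
    unfolding simple_def
  proof (intro conjI allI impI)
    show "finite (f ` \<Omega>)" using fin J by (meson finite_imageI finite_insert finite_subset)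
    show "f x = 0" if "x \<notin> \<Omega>" for x
      using that B sets_into_space by (intro zero) (meson subsetD)
    show "{x\<in>\<Omega>. f x = y} \<in> M" if "y \<noteq> 0" for y
      unfolding level[OF that] using J B by auto
  qed
  let ?T = "d ` J - {0}"
  \<comment> \<open>Values \<open>d j\<close> that \<open>f\<close> does not attain are added to the
    sum; their level sets are empty and contribute 0.\<close>
  have "integral f = (\<Sum>y\<in>?T. y * \<mu> {x\<in>\<Omega>. f x = y})"
    unfolding simple_integral_fa_def
  proof (rule sum.mono_neutral_left)
    show "\<forall>y\<in>?T - (f ` \<Omega> - {0}). y * \<mu> {x\<in>\<Omega>. f x = y} = 0"
    proof
      fix y assume "y \<in> ?T - (f ` \<Omega> - {0})"
      then have "{x\<in>\<Omega>. f x = y} = {}" by blast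
      then show "y * \<mu> {x\<in>\<Omega>. f x = y} = 0" by (simp only: measure_empty mult_zero_right)
    qed
  qed (use J fin in auto)
  also have "\<dots> = (\<Sum>y\<in>?T. \<Sum>j\<in>{j. j \<in> {j\<in>J. d j \<noteq> 0} \<and> d j = y}. d j * \<mu> (B j))"
  proof (rule sum.cong[OF refl])
    fix y assume y: "y \<in> ?T"
    have "(\<Sum>j\<in>{j\<in>J. d j = y}. \<mu> (B j)) = \<mu> {x\<in>\<Omega>. f x = y}"
      using y J B disj
      by (subst level) (auto intro!: finite_UN_eq_sum[symmetric] intro: disjoint_family_on_mono[rotated])
    moreover have "{j. j \<in> {j\<in>J. d j \<noteq> 0} \<and> d j = y} = {j\<in>J. d j = y}" using y by auto
    ultimately show "y * \<mu> {x\<in>\<Omega>. f x = y} = (\<Sum>j\<in>{j. j \<in> {j\<in>J. d j \<noteq> 0} \<and> d j = y}. d j * \<mu> (B j))"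
      by (simp flip: sum_distrib_left)
  qed
  also have "\<dots> = (\<Sum>j\<in>{j\<in>J. d j \<noteq> 0}. d j * \<mu> (B j))"
    using J by (intro sum.group) auto
  also have "\<dots> = (\<Sum>j\<in>J. d j * \<mu> (B j))"
    using J by (intro sum.mono_neutral_left) auto
  finally show "integral f = (\<Sum>j\<in>J. d j * \<mu> (B j))" .
qed

text \<open>A ring has differences but perhaps no complements: for \<open>z = 0\<close> the support
  of \<open>g\<close>, a finite union of level sets, is removed from the level set of
  \<open>f\<close>. The excluded pair (0, 0) would require a complement in
  \<open>\<Omega>\<close>.\<close>

lemma joint_level_set:
  assumes f: "simple f" and g: "simple g" and yz: "y \<noteq> 0 \<or> z \<noteq> 0"
  shows "{x\<in>\<Omega>. f x = y \<and> g x = z} \<in> M"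
proof -
  have level: "{x\<in>\<Omega>. u x = y} \<in> M" if "simple u" "y \<noteq> 0" for u y
    using that by (simp add: simple_def)
  have supp: "{x\<in>\<Omega>. u x \<noteq> 0} \<in> M" if u: "simple u" for u
  proof -
    have "{x\<in>\<Omega>. u x \<noteq> 0} = (\<Union>y\<in>u ` \<Omega> - {0}. {x\<in>\<Omega>. u x = y})" by auto
    also have "\<dots> \<in> M" using u by (intro finite_UN) (auto simp: simple_def)
    finally show ?thesis .
  qed
  consider "y \<noteq> 0" "z \<noteq> 0" | "y \<noteq> 0" "z = 0" | "y = 0" "z \<noteq> 0" using yz by blast
  then show ?thesis
  proof cases
    case 1
    have "{x\<in>\<Omega>. f x = y \<and> g x = z} = {x\<in>\<Omega>. f x = y} \<inter> {x\<in>\<Omega>. g x = z}" by auto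
    with 1 show ?thesis using level[OF f] level[OF g] by auto
  next
    case 2
    then have "{x\<in>\<Omega>. f x = y \<and> g x = z} = {x\<in>\<Omega>. f x = y} - {x\<in>\<Omega>. g x \<noteq> 0}" by auto
    with 2 show ?thesis using Diff[OF level[OF f] supp[OF g]] by simp
  next
    case 3
    then have "{x\<in>\<Omega>. f x = y \<and> g x = z} = {x\<in>\<Omega>. g x = z} - {x\<in>\<Omega>. f x \<noteq> 0}" by auto
    with 3 show ?thesis using Diff[OF level[OF g] supp[OF f]] by simp
  qed
qed

text \<open>The joint level sets serve as cells; the cell of (0, 0), possibly outside the ring, is
  dropped, which \<open>op 0 0 = 0\<close> makes harmless. With the two projections as
  \<open>op\<close>, the integrals of \<open>f\<close> and \<open>g\<close> become sums over the
  same cells and can be added or compared termwise.\<close>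

lemma combine:
  assumes f: "simple f" and g: "simple g" and op: "op 0 0 = 0"
  shows simple_combine: "simple (\<lambda>x. op (f x) (g x))"
    and integral_combine: "integral (\<lambda>x. op (f x) (g x)) =
      (\<Sum>j\<in>f ` \<Omega> \<times> g ` \<Omega> - {(0, 0)}. op (fst j) (snd j) * \<mu> {x\<in>\<Omega>. f x = fst j \<and> g x = snd j})"
proof -
  let ?J = "f ` \<Omega> \<times> g ` \<Omega> - {(0, 0)}"
  let ?B = "\<lambda>j. {x\<in>\<Omega>. f x = fst j \<and> g x = snd j}"
  have J: "finite ?J" using f g by (simp add: simple_def)
  have disj: "disjoint_family_on ?B ?J" by (auto simp: disjoint_family_on_def)
  have B: "?B j \<in> M" if "j \<in> ?J" for j
    using that by (intro joint_level_set[OF f g]) (auto simp: prod_eq_iff)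
  have d: "op (f x) (g x) = op (fst j) (snd j)" if "x \<in> ?B j" for j x
    using that by simp
  have zero: "op (f x) (g x) = 0" if "\<And>j. j \<in> ?J \<Longrightarrow> x \<notin> ?B j" for x
  proof (cases "f x = 0 \<and> g x = 0")
    case True
    then show ?thesis using op by simp
  next
    case False
    then have "x \<in> \<Omega>" using f g unfolding simple_def by blast
    with False have "(f x, g x) \<in> ?J" "x \<in> ?B (f x, g x)" by auto
    with that show ?thesis by blast
  qed
  note * = partition[where J = ?J and B = ?B and f = "\<lambda>x. op (f x) (g x)", OF J disj B d zero]
  show "simple (\<lambda>x. op (f x) (g x))" by (rule *(1))
  show "integral (\<lambda>x. op (f x) (g x)) = (\<Sum>j\<in>?J. op (fst j) (snd j) * \<mu> (?B j))" by (rule *(2))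
qed

lemma simple_diff: "simple f \<Longrightarrow> simple g \<Longrightarrow> simple (\<lambda>x. f x - g x)"
  by (rule simple_combine[where op = "(-)"]) auto

lemma simple_add: "simple f \<Longrightarrow> simple g \<Longrightarrow> simple (\<lambda>x. f x + g x)"
  by (rule simple_combine[where op = "(+)"]) auto

lemma simple_abs: "simple f \<Longrightarrow> simple (\<lambda>x. \<bar>f x\<bar>)"
  by (rule simple_combine[where op = "\<lambda>y z. \<bar>y\<bar>"]) auto

lemma integral_add:
  assumes "simple f" "simple g"
  shows "integral (\<lambda>x. f x + g x) = integral f + integral g"
  using integral_combine[OF assms, of "(+)"] integral_combine[OF assms, of "\<lambda>y z. y"]
    integral_combine[OF assms, of "\<lambda>y z. z"]
  by (simp add: distrib_right sum.distrib)

lemma integral_mono: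
  assumes f: "simple f" and g: "simple g" and le: "\<And>x. x \<in> \<Omega> \<Longrightarrow> f x \<le> g x"
  shows "integral f \<le> integral g"
proof -
  let ?J = "f ` \<Omega> \<times> g ` \<Omega> - {(0, 0)}"
  let ?B = "\<lambda>j. {x\<in>\<Omega>. f x = fst j \<and> g x = snd j}"
  have "(\<Sum>j\<in>?J. fst j * \<mu> (?B j)) \<le> (\<Sum>j\<in>?J. snd j * \<mu> (?B j))"
  proof (rule sum_mono)
    fix j assume "j \<in> ?J"
    then have B: "?B j \<in> M" by (intro joint_level_set[OF f g]) (auto simp: prod_eq_iff)
    show "fst j * \<mu> (?B j) \<le> snd j * \<mu> (?B j)"
    \<comment> \<open>Values never attained at a common point need not be ordered, but their cell is
      empty and has measure 0.\<close>
    proof (cases "?B j = {}")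
      case True
      then show ?thesis by (simp only: measure_empty)
    next
      case False
      then have "fst j \<le> snd j" using le by force
      then show ?thesis using nonneg[OF B] by (rule mult_right_mono)
    qed
  qed
  then show ?thesis
    using integral_combine[OF f g, of "\<lambda>y z. y"] integral_combine[OF f g, of "\<lambda>y z. z"] by simp
qed

lemma simple_scaled_indicator: "A \<in> M \<Longrightarrow> simple (\<lambda>x. c * indicator A x)"
  by (rule simple_partition[where J = "{()}" and B = "\<lambda>_. A" and d = "\<lambda>_. c"])
    (auto simp: disjoint_family_on_def)

lemma integral_scaled_indicator: "A \<in> M \<Longrightarrow> integral (\<lambda>x. c * indicator A x) = c * \<mu> A"
  by (subst integral_partition[where J = "{()}" and B = "\<lambda>_. A" and d = "\<lambda>_. c"])
    (auto simp: disjoint_family_on_def)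

lemma integral_diff:
  assumes "simple f" "simple g"
  shows "integral (\<lambda>x. f x - g x) = integral f - integral g"
  using integral_add[OF simple_diff[OF assms] assms(2)] by simp

lemma abs_integral_diff_le:
  assumes "simple f" "simple g"
  shows "\<bar>integral f - integral g\<bar> \<le> integral (\<lambda>x. \<bar>f x - g x\<bar>)"
proof -
  have "integral f \<le> integral (\<lambda>x. g x + \<bar>f x - g x\<bar>)" "integral g \<le> integral (\<lambda>x. f x + \<bar>f x - g x\<bar>)"
    using assms by (auto intro!: integral_mono simple_add simple_abs simple_diff)
  then show ?thesis
    using assms by (simp add: integral_add simple_abs simple_diff)
qed

lemma simple_functions_eq: "simple_functions M = Collect simple"
proof (intro set_eqI iffI)
  fix f assume "f \<in> simple_functions M"
  then obtain F c where F: "finite F" "F \<subseteq> M" and f: "f = (\<lambda>x. \<Sum>A\<in>F. c A * indicator A x)"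
    unfolding simple_functions_def by blast
  have "simple (\<lambda>x. \<Sum>A\<in>F. c A * indicator A x)"
    using F
  proof induction
    case empty
    have "simple (\<lambda>x. 0 * indicator {} x)" by (rule simple_scaled_indicator) simp
    then show ?case by simp
  next
    case (insert A F)
    then show ?case
      unfolding sum.insert[OF insert.hyps] by (intro simple_add simple_scaled_indicator) blast+
  qed
  then show "f \<in> Collect simple" by (simp add: f)
next
  fix f assume "f \<in> Collect simple"
  then have f: "simple f" by simp
  let ?L = "\<lambda>y. {x\<in>\<Omega>. f x = y}"
  let ?Y = "f ` \<Omega> - {0}"
  \<comment> \<open>In \<open>simple_functions\<close> the coefficients are indexed by sets, so the
    value on a level set is read off at a chosen point of it.\<close>
  define c where "c A = f (SOME x. x \<in> A)" for A
  have inj: "inj_on ?L ?Y" by (rule inj_onI) auto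
  have c: "c (?L y) = y" if "y \<in> ?Y" for y
  proof -
    have "\<exists>x. x \<in> ?L y" using that by auto
    then have "(SOME x. x \<in> ?L y) \<in> ?L y" by (rule someI_ex)
    then show ?thesis by (simp add: c_def)
  qed
  have fin: "finite ?Y" using f by (simp add: simple_def)
  have "f = (\<lambda>x. \<Sum>A\<in>?L ` ?Y. c A * indicator A x)"
  proof
    fix x
    have "(\<Sum>A\<in>?L ` ?Y. c A * indicator A x) = (\<Sum>y\<in>?Y. y * indicator (?L y) x)"
      using c by (subst sum.reindex[OF inj]) (auto intro!: sum.cong)
    also have "\<dots> = (\<Sum>y\<in>?Y. if y = f x then (if x \<in> \<Omega> then f x else 0) else 0)"
      by (intro sum.cong) (auto simp: indicator_def)
    also have "\<dots> = f x" using f fin by (auto simp: simple_def)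
    finally show "f x = (\<Sum>A\<in>?L ` ?Y. c A * indicator A x)" ..
  qed
  moreover have "finite (?L ` ?Y)" "?L ` ?Y \<subseteq> M" using f by (auto simp: simple_def)
  ultimately show "f \<in> simple_functions M" unfolding simple_functions_def by blast
qed

section \<open>Convergence up to small sets and approximating sequences\<close>

text \<open>An outer value below \<open>e\<close> means that a member of the ring with measure below
  \<open>e\<close> covers the set. Outer values being nonnegative, convergence to 0 amounts to being
  eventually below every positive real.\<close>

lemma converges_fa_iff:
  "converges_fa \<Omega> M \<mu> Xs X \<longleftrightarrow>
    (\<forall>c>0. \<forall>e>0. \<forall>\<^sub>F n in sequentially. \<exists>E\<in>M. \<mu> E < e \<and> (\<forall>x\<in>\<Omega> - E. \<bar>Xs n x - X x\<bar> \<le> c))"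
proof -
  have ge: "outer_value M \<mu> E \<ge> 0" for E
    unfolding outer_value_def using nonneg by (auto intro!: INF_greatest)
  have less: "outer_value M \<mu> {x\<in>\<Omega>. \<bar>Xs n x - X x\<bar> > c} < ereal e \<longleftrightarrow>
      (\<exists>E\<in>M. \<mu> E < e \<and> (\<forall>x\<in>\<Omega> - E. \<bar>Xs n x - X x\<bar> \<le> c))" for n c e
    unfolding outer_value_def INF_less_iff by (force simp: not_less)
  have lim: "(\<lambda>n. u n) \<longlonglongrightarrow> 0 \<longleftrightarrow> (\<forall>e>0. \<forall>\<^sub>F n in sequentially. u n < ereal e)"
    if u: "\<And>n. 0 \<le> u n" for u :: "nat \<Rightarrow> ereal"
  proof
    assume "(\<lambda>n. u n) \<longlonglongrightarrow> 0"
    then show "\<forall>e>0. \<forall>\<^sub>F n in sequentially. u n < ereal e" by (auto intro: order_tendstoD)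
  next
    assume *: "\<forall>e>0. \<forall>\<^sub>F n in sequentially. u n < ereal e"
    show "(\<lambda>n. u n) \<longlonglongrightarrow> 0"
    proof (rule order_tendstoI)
      fix a :: ereal assume "a < 0"
      then show "\<forall>\<^sub>F n in sequentially. a < u n" using u by (intro always_eventually allI) (rule less_le_trans)
    next
      fix a :: ereal assume "0 < a"
      then obtain e where "0 < ereal e" "ereal e < a" using ereal_dense2[of 0 a] by auto
      with * show "\<forall>\<^sub>F n in sequentially. u n < a" by (auto elim!: eventually_mono)
    qed
  qed
  show ?thesis
    unfolding converges_fa_def lim[OF ge] less ..
qed

text \<open>Tolerances are halved and exceptional sets united; the Cauchy property follows from the
  triangle inequality. This reduces the comparison of two approximating sequences to a bound for
  their difference.\<close>

lemma approximates_diff: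
  assumes X: "approximates_fa \<Omega> M \<mu> Xs X" and Y: "approximates_fa \<Omega> M \<mu> Ys Y"
  shows "approximates_fa \<Omega> M \<mu> (\<lambda>n x. Xs n x - Ys n x) (\<lambda>x. X x - Y x)"
  unfolding approximates_fa_def
proof (intro conjI allI impI)
  have s: "simple (Xs n)" "simple (Ys n)" for n
    using X Y by (auto simp: approximates_fa_def simple_functions_eq)
  then show "(\<lambda>x. Xs n x - Ys n x) \<in> simple_functions M" for n
    by (simp add: simple_functions_eq simple_diff)
  show "converges_fa \<Omega> M \<mu> (\<lambda>n x. Xs n x - Ys n x) (\<lambda>x. X x - Y x)"
    unfolding converges_fa_iff
  proof (intro allI impI)
    fix c e :: real assume "0 < c" "0 < e"
    then have ce: "0 < c/2" "0 < e/2" by simp_all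
    have "\<forall>\<^sub>F n in sequentially. \<exists>E\<in>M. \<mu> E < e/2 \<and> (\<forall>x\<in>\<Omega> - E. \<bar>Xs n x - X x\<bar> \<le> c/2)"
      using X unfolding approximates_fa_def converges_fa_iff by (elim conjE allE impE) (rule ce | assumption)+
    moreover have "\<forall>\<^sub>F n in sequentially. \<exists>E\<in>M. \<mu> E < e/2 \<and> (\<forall>x\<in>\<Omega> - E. \<bar>Ys n x - Y x\<bar> \<le> c/2)"
      using Y unfolding approximates_fa_def converges_fa_iff by (elim conjE allE impE) (rule ce | assumption)+
    ultimately show "\<forall>\<^sub>F n in sequentially. \<exists>E\<in>M. \<mu> E < e \<and>
        (\<forall>x\<in>\<Omega> - E. \<bar>Xs n x - Ys n x - (X x - Y x)\<bar> \<le> c)"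
    proof eventually_elim
      case (elim n)
      then obtain E F where E: "E \<in> M" "\<mu> E < e/2" "\<And>x. x \<in> \<Omega> - E \<Longrightarrow> \<bar>Xs n x - X x\<bar> \<le> c/2"
        and F: "F \<in> M" "\<mu> F < e/2" "\<And>x. x \<in> \<Omega> - F \<Longrightarrow> \<bar>Ys n x - Y x\<bar> \<le> c/2"
        by blast
      show ?case
      proof (intro bexI conjI ballI)
        show "\<mu> (E \<union> F) < e" using Un_le[OF E(1) F(1)] E(2) F(2) by linarith
        show "\<bar>Xs n x - Ys n x - (X x - Y x)\<bar> \<le> c" if "x \<in> \<Omega> - (E \<union> F)" for x
        proof -
          have "\<bar>Xs n x - X x\<bar> \<le> c/2" "\<bar>Ys n x - Y x\<bar> \<le> c/2" using E(3) F(3) that by auto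
          then show ?thesis by arith
        qed
      qed (use E F in auto)
    qed
  qed
  fix e :: real assume e: "0 < e"
  obtain N1 where N1: "\<And>m n. N1 \<le> m \<Longrightarrow> N1 \<le> n \<Longrightarrow> integral (\<lambda>x. \<bar>Xs n x - Xs m x\<bar>) < e/2"
    using X e unfolding approximates_fa_def by (meson half_gt_zero)
  obtain N2 where N2: "\<And>m n. N2 \<le> m \<Longrightarrow> N2 \<le> n \<Longrightarrow> integral (\<lambda>x. \<bar>Ys n x - Ys m x\<bar>) < e/2"
    using Y e unfolding approximates_fa_def by (meson half_gt_zero)
  show "\<exists>N. \<forall>m\<ge>N. \<forall>n\<ge>N. integral (\<lambda>x. \<bar>Xs n x - Ys n x - (Xs m x - Ys m x)\<bar>) < e"
  proof (intro exI allI impI)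
    fix m n assume mn: "max N1 N2 \<le> m" "max N1 N2 \<le> n"
    have "integral (\<lambda>x. \<bar>Xs n x - Ys n x - (Xs m x - Ys m x)\<bar>)
        \<le> integral (\<lambda>x. \<bar>Xs n x - Xs m x\<bar> + \<bar>Ys n x - Ys m x\<bar>)"
      using s by (intro integral_mono simple_abs simple_diff simple_add) auto
    also have "\<dots> = integral (\<lambda>x. \<bar>Xs n x - Xs m x\<bar>) + integral (\<lambda>x. \<bar>Ys n x - Ys m x\<bar>)"
      using s by (intro integral_add simple_abs simple_diff)
    also have "\<dots> < e" using N1[of m n] N2[of m n] mn by simp
    finally show "integral (\<lambda>x. \<bar>Xs n x - Ys n x - (Xs m x - Ys m x)\<bar>) < e" .
  qed
qed

lemma integral_convergent:
  assumes "approximates_fa \<Omega> M \<mu> Xs X"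
  shows "convergent (\<lambda>n. integral (Xs n))"
proof -
  have s: "simple (Xs n)" for n
    using assms by (auto simp: approximates_fa_def simple_functions_eq)
  have "Cauchy (\<lambda>n. integral (Xs n))"
  proof (rule CauchyI)
    fix e :: real assume "0 < e"
    then obtain N where "\<And>m n. N \<le> m \<Longrightarrow> N \<le> n \<Longrightarrow> integral (\<lambda>x. \<bar>Xs n x - Xs m x\<bar>) < e"
      using assms unfolding approximates_fa_def by meson
    then show "\<exists>N. \<forall>m\<ge>N. \<forall>n\<ge>N. norm (integral (Xs m) - integral (Xs n)) < e"
      using abs_integral_diff_le[OF s s] unfolding real_norm_def by (meson le_less_trans)
  qed
  then show ?thesis by (simp add: Cauchy_convergent_iff)
qed

end

section \<open>Probability structures: lower bounds and uniqueness of the integral\<close>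

locale finitely_additive_prob = finitely_additive +
  assumes Sup_eq_1: "(SUP A\<in>M. ereal (\<mu> A)) = 1"
begin

lemma le_1: "A \<in> M \<Longrightarrow> \<mu> A \<le> 1"
  using SUP_upper[of A M "\<lambda>A. ereal (\<mu> A)"] Sup_eq_1 by simp

text \<open>Convergence controls \<open>Zs n\<close> only off a small set \<open>E\<close>. On
  \<open>E\<close> it is compared with the fixed bounded function \<open>Zs N\<close>, at a cost
  that the Cauchy property keeps small. As \<open>\<Omega>\<close> may lie outside the ring, the
  constant is integrated over a member \<open>A\<close> of nearly full measure.\<close>

lemma integral_limit_ge:
  assumes Zs: "approximates_fa \<Omega> M \<mu> Zs Z" and Z: "\<And>x. x \<in> \<Omega> \<Longrightarrow> a \<le> Z x"
    and r: "(\<lambda>n. integral (Zs n)) \<longlonglongrightarrow> r"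
  shows "a \<le> r"
proof (rule field_le_epsilon)
  fix e' :: real assume "0 < e'"
  \<comment> \<open>Four errors of size \<open>e\<close> will add up: lowering \<open>a\<close>,
    passing to the limit \<open>r\<close>, the Cauchy property, and the terms with
    \<open>\<delta>\<close>.\<close>
  define e where "e = e' / 4"
  have e: "0 < e" using \<open>0 < e'\<close> by (simp add: e_def)
  have s: "simple (Zs n)" for n
    using Zs by (auto simp: approximates_fa_def simple_functions_eq)
  obtain N where N: "\<And>n. N \<le> n \<Longrightarrow> integral (\<lambda>x. \<bar>Zs n x - Zs N x\<bar>) < e"
    using Zs e unfolding approximates_fa_def by (meson order_refl)
  obtain K0 where K0: "\<And>x. x \<in> \<Omega> \<Longrightarrow> \<bar>Zs N x\<bar> \<le> K0"
    using s[of N] finite_imp_bounded[of "Zs N ` \<Omega>"] by (auto simp: simple_def bounded_iff)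
  define K where "K = max \<bar>a\<bar> (max K0 0)"
  have K: "\<bar>a\<bar> \<le> K" "0 \<le> K" "\<And>x. x \<in> \<Omega> \<Longrightarrow> \<bar>Zs N x\<bar> \<le> K"
    using K0 by (auto simp: K_def le_max_iff_disj)
  \<comment> \<open>Makes the cost \<open>2 * K * \<delta>\<close> of \<open>E\<close> and the cost
    \<open>(K + e) * \<delta>\<close> of the mass missing from \<open>A\<close> sum to
    \<open>e\<close>.\<close>
  define \<delta> where "\<delta> = e / (3 * K + e)"
  have pos: "0 < 3 * K + e" using K(2) e by linarith
  then have \<delta>: "0 < \<delta>" "(3 * K + e) * \<delta> = e" using e by (simp_all add: \<delta>_def)
  have "\<forall>\<^sub>F n in sequentially. \<exists>E\<in>M. \<mu> E < \<delta> \<and> (\<forall>x\<in>\<Omega> - E. \<bar>Zs n x - Z x\<bar> \<le> e)"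
    using Zs e \<delta>(1) unfolding approximates_fa_def converges_fa_iff by simp
  moreover have "\<forall>\<^sub>F n in sequentially. integral (Zs n) < r + e"
    using r e by (auto intro: order_tendstoD)
  ultimately have "\<forall>\<^sub>F n in sequentially. N \<le> n \<and> integral (Zs n) < r + e \<and>
      (\<exists>E\<in>M. \<mu> E < \<delta> \<and> (\<forall>x\<in>\<Omega> - E. \<bar>Zs n x - Z x\<bar> \<le> e))"
    by (intro eventually_conj eventually_ge_at_top)
  then obtain n E where n: "N \<le> n" "integral (Zs n) < r + e"
    and E: "E \<in> M" "\<mu> E < \<delta>" "\<And>x. x \<in> \<Omega> - E \<Longrightarrow> \<bar>Zs n x - Z x\<bar> \<le> e"
    by (auto simp: eventually_sequentially)
  obtain A0 where A0: "A0 \<in> M" "1 - \<delta> < \<mu> A0"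
    using less_SUP_iff[of "ereal (1 - \<delta>)" "\<lambda>A. ereal (\<mu> A)" M] \<delta>(1) Sup_eq_1 by (auto simp: one_ereal_def)
  define supp where "supp = (\<Union>y\<in>Zs n ` \<Omega> - {0}. {x\<in>\<Omega>. Zs n x = y})"
  have supp: "supp \<in> M"
    using s[of n] unfolding supp_def by (intro finite_UN) (auto simp: simple_def)
  \<comment> \<open>Besides almost all the mass, \<open>A\<close> takes in \<open>E\<close> and the
    support of \<open>Zs n\<close>, so that off \<open>A\<close> the left side of
    \<open>pointwise\<close> is 0 and the right side is a nonnegative deviation.\<close>
  define A where "A = A0 \<union> E \<union> supp"
  have A: "A \<in> M" using A0 E supp by (auto simp: A_def)
  have "\<mu> A0 \<le> \<mu> A" using A0 A by (intro mono) (auto simp: A_def)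
  with A0 have A1: "1 - \<delta> \<le> \<mu> A" by linarith
  have pointwise: "(a - e) * indicator A x \<le> Zs n x + (\<bar>Zs n x - Zs N x\<bar> + 2 * K * indicator E x)"
    if x: "x \<in> \<Omega>" for x
  proof -
    consider "x \<notin> A" | "x \<in> A" "x \<notin> E" | "x \<in> A" "x \<in> E" by blast
    then show ?thesis
    proof cases
      case 1
      then have "Zs n x = 0" "x \<notin> E" using x by (auto simp: A_def supp_def)
      with 1 show ?thesis by simp
    next
      case 2
      then show ?thesis using Z[OF x] E(3)[of x] x by simp
    next
      \<comment> \<open>Here \<open>Zs n x\<close> plus its distance from \<open>Zs N x\<close> is
        at least \<open>Zs N x\<close>, hence at least \<open>- K\<close>, and the term
        \<open>2 * K\<close> lifts this to \<open>K\<close>, which bounds \<open>a\<close>.\<close>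
      case 3
      then show ?thesis using K(1) K(3)[OF x] e by simp
    qed
  qed
  have "(a - e) * \<mu> A = integral (\<lambda>x. (a - e) * indicator A x)"
    using A by (simp only: integral_scaled_indicator)
  also have "\<dots> \<le> integral (\<lambda>x. Zs n x + (\<bar>Zs n x - Zs N x\<bar> + 2 * K * indicator E x))"
    using s A E by (intro integral_mono simple_add simple_abs simple_diff simple_scaled_indicator pointwise) auto
  also have "\<dots> = integral (Zs n) + (integral (\<lambda>x. \<bar>Zs n x - Zs N x\<bar>) + 2 * K * \<mu> E)"
    using s E by (simp only: integral_add simple_add simple_abs simple_diff simple_scaled_indicator integral_scaled_indicator)
  also have "\<dots> \<le> r + e + (e + 2 * K * \<delta>)"
    using n N[OF n(1)] E(2) K(2) by (intro add_mono mult_left_mono) auto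
  finally have 1: "(a - e) * \<mu> A \<le> r + e + (e + 2 * K * \<delta>)" .
  have "(a - e) * (1 - \<mu> A) \<le> (K + e) * \<delta>"
    using K(1) e A1 le_1[OF A] by (intro mult_mono) auto
  moreover have "a - e = (a - e) * \<mu> A + (a - e) * (1 - \<mu> A)" by (simp add: algebra_simps)
  moreover have "2 * K * \<delta> + (K + e) * \<delta> = e" using \<delta>(2) by (simp add: algebra_simps)
  ultimately show "a \<le> r + e'" using 1 by (simp add: e_def)
qed

text \<open>The differences of two sequences approximating \<open>X\<close> approximate 0, so
  \<open>integral_limit_ge\<close> with \<open>a = 0\<close> orders the two limits. Exchanging the
  sequences gives the uniqueness that the definite description requires.\<close>

lemma integral_fa_eqI:
  assumes Xs: "approximates_fa \<Omega> M \<mu> Xs X" and r: "(\<lambda>n. integral (Xs n)) \<longlonglongrightarrow> r"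
  shows "integral_fa \<Omega> M \<mu> X = r"
proof -
  have le: "r2 \<le> r1" if "approximates_fa \<Omega> M \<mu> Xs1 X" "(\<lambda>n. integral (Xs1 n)) \<longlonglongrightarrow> r1"
    "approximates_fa \<Omega> M \<mu> Xs2 X" "(\<lambda>n. integral (Xs2 n)) \<longlonglongrightarrow> r2" for Xs1 Xs2 r1 r2
  proof -
    have "simple (Xs1 n)" "simple (Xs2 n)" for n
      using that(1,3) by (auto simp: approximates_fa_def simple_functions_eq)
    then have "(\<lambda>n. integral (\<lambda>x. Xs1 n x - Xs2 n x)) \<longlonglongrightarrow> r1 - r2"
      using that by (simp add: integral_diff tendsto_diff)
    with integral_limit_ge[OF approximates_diff[OF that(1,3)], of 0 "r1 - r2"] show ?thesis by simp
  qed
  show ?thesis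
    unfolding integral_fa_def
  proof (rule the_equality)
    fix r' assume "\<exists>Xs. approximates_fa \<Omega> M \<mu> Xs X \<and> (\<lambda>n. integral (Xs n)) \<longlonglongrightarrow> r'"
    then show "r' = r" using le Xs r by (meson order_antisym)
  qed (use Xs r in blast)
qed

lemma integral_fa_ge:
  assumes "X \<in> L1_fa \<Omega> M \<mu>" and "\<And>x. x \<in> \<Omega> \<Longrightarrow> a \<le> X x"
  shows "a \<le> integral_fa \<Omega> M \<mu> X"
proof -
  obtain Xs where Xs: "approximates_fa \<Omega> M \<mu> Xs X" using assms(1) by (auto simp: L1_fa_def)
  then obtain r where "(\<lambda>n. integral (Xs n)) \<longlonglongrightarrow> r"
    using integral_convergent by (auto simp: convergent_def)
  then show ?thesis using integral_fa_eqI[OF Xs] integral_limit_ge[OF Xs assms(2)] by simp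
qed

end

lemma finitely_additive_prob_iff:
  "finitely_additive_prob \<Omega> M \<mu> \<longleftrightarrow> probability_structure \<Omega> M \<mu>"
  unfolding finitely_additive_prob_def finitely_additive_prob_axioms_def finitely_additive_def
    finitely_additive_axioms_def probability_structure_def measure_structure_def by blast

section \<open>Linear minorants of sublinear functionals\<close>

text \<open>Members are total functions with plain pointwise operations, unlike those of
  \<open>function_subspace\<close>, which are undefined off their carrier.\<close>

definition function_space :: "('a \<Rightarrow> real) set \<Rightarrow> bool" where
  "function_space U \<longleftrightarrow> (\<forall>f\<in>U. \<forall>g\<in>U. (\<lambda>x. f x + g x) \<in> U) \<and> (\<forall>c. \<forall>f\<in>U. (\<lambda>x. c * f x) \<in> U)"

text \<open>Homogeneity is an inequality, the form that passes directly to infima;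
  \<open>sublinear_on_scale\<close> recovers equality.\<close>

definition sublinear_on :: "('a \<Rightarrow> real) set \<Rightarrow> (('a \<Rightarrow> real) \<Rightarrow> real) \<Rightarrow> bool" where
  "sublinear_on U p \<longleftrightarrow> (\<forall>f\<in>U. \<forall>g\<in>U. p (\<lambda>x. f x + g x) \<le> p f + p g) \<and>
    (\<forall>c\<ge>0. \<forall>f\<in>U. p (\<lambda>x. c * f x) \<le> c * p f)"

lemma function_spaceD:
  assumes "function_space U"
  shows "f \<in> U \<Longrightarrow> g \<in> U \<Longrightarrow> (\<lambda>x. f x + g x) \<in> U" "f \<in> U \<Longrightarrow> (\<lambda>x. c * f x) \<in> U"
    "f \<in> U \<Longrightarrow> (\<lambda>x. - f x) \<in> U" "f \<in> U \<Longrightarrow> (\<lambda>x. 0) \<in> U"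
proof -
  show add: "f \<in> U \<Longrightarrow> g \<in> U \<Longrightarrow> (\<lambda>x. f x + g x) \<in> U" and scale: "f \<in> U \<Longrightarrow> (\<lambda>x. c * f x) \<in> U"
    for f c using assms by (auto simp: function_space_def)
  show "f \<in> U \<Longrightarrow> (\<lambda>x. - f x) \<in> U" using scale[of f "-1"] by simp
  show "f \<in> U \<Longrightarrow> (\<lambda>x. 0) \<in> U" using scale[of f 0] by simp
qed

lemma sublinear_onD:
  assumes "sublinear_on U p"
  shows "f \<in> U \<Longrightarrow> g \<in> U \<Longrightarrow> p (\<lambda>x. f x + g x) \<le> p f + p g"
    "0 \<le> c \<Longrightarrow> f \<in> U \<Longrightarrow> p (\<lambda>x. c * f x) \<le> c * p f"
  using assms by (auto simp: sublinear_on_def)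

lemma sublinear_on_zero:
  assumes U: "function_space U" and p: "sublinear_on U p" and f: "f \<in> U"
  shows "p (\<lambda>x. 0) = 0"
  using sublinear_onD(1)[OF p function_spaceD(4)[OF U f] function_spaceD(4)[OF U f]]
    sublinear_onD(2)[OF p order_refl f] by simp

lemma sublinear_on_minus_ge:
  assumes U: "function_space U" and p: "sublinear_on U p" and f: "f \<in> U"
  shows "- p (\<lambda>x. - f x) \<le> p f"
  using sublinear_onD(1)[OF p f function_spaceD(3)[OF U f]] sublinear_on_zero[OF U p f] by simp

lemma sublinear_on_scale:
  assumes U: "function_space U" and p: "sublinear_on U p" and c: "0 \<le> c" and f: "f \<in> U"
  shows "p (\<lambda>x. c * f x) = c * p f"
proof (cases "c = 0")
  case True
  then show ?thesis using sublinear_on_zero[OF U p f] by simp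
next
  case False
  then have "p f \<le> p (\<lambda>x. c * f x) / c"
    using sublinear_onD(2)[OF p _ function_spaceD(2)[OF U f], of "1/c" c] c by simp
  then show ?thesis
    using sublinear_onD(2)[OF p c f] c False by (simp add: field_simps)
qed

text \<open>Zorn's lemma, with pointwise infima as lower bounds of chains. They are finite on
  \<open>U\<close> because every candidate satisfies
  \<open>- q (\<lambda>x. - f x) \<le> m f\<close>.\<close>

lemma exists_minimal_sublinear:
  assumes U: "function_space U" and q: "sublinear_on U q"
  shows "\<exists>m. sublinear_on U m \<and> (\<forall>f\<in>U. m f \<le> q f) \<and>
    (\<forall>n. sublinear_on U n \<longrightarrow> (\<forall>f\<in>U. n f \<le> m f) \<longrightarrow> (\<forall>f\<in>U. n f = m f))"
proof -
  \<comment> \<open>Outside \<open>U\<close> all candidates agree with \<open>q\<close>, so that the order \<open>P\<close> is antisymmetric.\<close>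
  define A where "A = {m. sublinear_on U m \<and> (\<forall>f\<in>U. m f \<le> q f) \<and> (\<forall>f. f \<notin> U \<longrightarrow> m f = q f)}"
  \<comment> \<open>The order is reversed: maximal for \<open>P\<close> means pointwise minimal on
    \<open>U\<close>.\<close>
  define P where "P = (\<lambda>m n. \<forall>f\<in>U. n f \<le> (m f :: real))"
  have "\<exists>m\<in>A. \<forall>n\<in>A. P m n \<longrightarrow> n = m"
  proof (rule predicate_Zorn)
    show "partial_order_on A (relation_of P A)"
    proof (rule partial_order_on_relation_ofI)
      fix m n assume "m \<in> A" "n \<in> A" "P m n" "P n m"
      then show "m = n" by (intro ext) (metis (mono_tags, lifting) A_def P_def mem_Collect_eq order_antisym)
    qed (auto simp: P_def intro: order_trans)
  next
    fix C assume C: "C \<in> Chains (relation_of P A)"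
    then have CA: "C \<subseteq> A" by (auto simp: Chains_def relation_of_def)
    have chain: "P m n \<or> P n m" if "m \<in> C" "n \<in> C" for m n
      using C that by (auto simp: Chains_def relation_of_def)
    show "\<exists>u\<in>A. \<forall>m\<in>C. P m u"
    proof (cases "C = {}")
      case True
      then show ?thesis using q by (auto simp: A_def intro!: exI[of _ q])
    next
      case False
      define u where "u f = (if f \<in> U then INF m\<in>C. m f else q f)" for f
      have bdd: "bdd_below ((\<lambda>m. m f) ` C)" if f: "f \<in> U" for f
      proof (rule bdd_belowI2)
        fix m assume "m \<in> C"
        then have m: "sublinear_on U m" "m (\<lambda>x. - f x) \<le> q (\<lambda>x. - f x)"
          using CA function_spaceD(3)[OF U f] by (auto simp: A_def)
        show "- q (\<lambda>x. - f x) \<le> m f"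
          using sublinear_on_minus_ge[OF U m(1) f] m(2) by linarith
      qed
      have lower: "u f \<le> m f" if "m \<in> C" "f \<in> U" for m f
        using cINF_lower[OF bdd[OF that(2)] that(1)] that(2) by (simp add: u_def)
      have greatest: "b \<le> u f" if "f \<in> U" "\<And>m. m \<in> C \<Longrightarrow> b \<le> m f" for b f
        using that False by (simp add: u_def cINF_greatest)
      have subl: "sublinear_on U m" if "m \<in> C" for m using that CA by (auto simp: A_def)
      have "sublinear_on U u"
        unfolding sublinear_on_def
      proof (intro conjI ballI allI impI)
        fix f g assume f: "f \<in> U" and g: "g \<in> U"
        have *: "u (\<lambda>x. f x + g x) \<le> m f + n g" if mn: "m \<in> C" "n \<in> C" for m n
        proof -
          \<comment> \<open>The smaller of \<open>m\<close> and \<open>n\<close> serves both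
            summands; this is where the chain property enters.\<close>
          obtain t where t: "t \<in> C" "t f \<le> m f" "t g \<le> n g"
            using chain[OF mn] mn f g unfolding P_def by blast
          have "u (\<lambda>x. f x + g x) \<le> t (\<lambda>x. f x + g x)"
            using lower[OF t(1) function_spaceD(1)[OF U f g]] .
          also have "\<dots> \<le> t f + t g" by (rule sublinear_onD(1)[OF subl[OF t(1)] f g])
          finally show ?thesis using t by linarith
        qed
        \<comment> \<open>The infima over \<open>m\<close> and \<open>n\<close> are taken one after
          the other, with the remaining term moved across.\<close>
        have "u (\<lambda>x. f x + g x) - n g \<le> u f" if "n \<in> C" for n
          using *[OF _ that] by (intro greatest[OF f]) (simp add: algebra_simps)
        then have "u (\<lambda>x. f x + g x) - u f \<le> u g"
          by (intro greatest[OF g]) (simp add: algebra_simps)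
        then show "u (\<lambda>x. f x + g x) \<le> u f + u g" by simp
      next
        fix c :: real and f assume c: "0 \<le> c" and f: "f \<in> U"
        have *: "u (\<lambda>x. c * f x) \<le> c * m f" if "m \<in> C" for m
          using lower[OF that function_spaceD(2)[OF U f]] sublinear_onD(2)[OF subl[OF that] c f]
          by (rule order_trans)
        show "u (\<lambda>x. c * f x) \<le> c * u f"
        proof (cases "c = 0")
          case True
          then show ?thesis using * False by auto
        next
          case False
          then have "u (\<lambda>x. c * f x) / c \<le> u f"
            using * c by (intro greatest[OF f]) (simp add: field_simps)
          then show ?thesis using c False by (simp add: field_simps)
        qed
      qed
      moreover have "u f \<le> q f" if "f \<in> U" for f
      proof -
        obtain m where "m \<in> C" using False by blast
        then show ?thesis using lower[of m f] CA that by (force simp: A_def)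
      qed
      ultimately have "u \<in> A" by (auto simp: A_def u_def)
      then show ?thesis using lower by (auto simp: P_def)
    qed
  qed
  then obtain m where m: "m \<in> A" and min: "\<And>n. n \<in> A \<Longrightarrow> P m n \<Longrightarrow> n = m" by blast
  have "n f = m f" if n: "sublinear_on U n" "\<forall>f\<in>U. n f \<le> m f" and f: "f \<in> U" for n f
  proof -
    let ?n = "\<lambda>f. if f \<in> U then n f else q f"
    have "sublinear_on U ?n"
      using n(1) function_spaceD[OF U] by (simp add: sublinear_on_def)
    then have "?n = m" using m n(2) by (intro min) (force simp: A_def P_def)+
    then show ?thesis using f by meson
  qed
  then show ?thesis using m by (auto simp: A_def)
qed

text \<open>A Hahn-Banach theorem: a minimal sublinear functional is linear. Superadditivity is the
  point; additivity then makes \<open>m\<close> odd, which gives homogeneity for negative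
  factors.\<close>

lemma exists_linear_minorant:
  assumes U: "function_space U" and q: "sublinear_on U q"
  shows "\<exists>l. (\<forall>f\<in>U. \<forall>g\<in>U. l (\<lambda>x. f x + g x) = l f + l g) \<and>
    (\<forall>c. \<forall>f\<in>U. l (\<lambda>x. c * f x) = c * l f) \<and> (\<forall>f\<in>U. l f \<le> q f)"
proof -
  obtain m where m: "sublinear_on U m" and le: "\<And>f. f \<in> U \<Longrightarrow> m f \<le> q f"
    and min: "\<And>n f. sublinear_on U n \<Longrightarrow> (\<And>f. f \<in> U \<Longrightarrow> n f \<le> m f) \<Longrightarrow> f \<in> U \<Longrightarrow> n f = m f"
    using exists_minimal_sublinear[OF U q] by metis
  note clos = function_spaceD[OF U]
  \<comment> \<open>Sliding \<open>m\<close> along \<open>g\<close> gives a sublinear minorant of \<open>m\<close>, so \<open>m\<close> is superadditive by minimality.\<close>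
  have super: "m f + m g \<le> m (\<lambda>x. f x + g x)" if g: "g \<in> U" and f0: "f \<in> U" for f g
  proof -
    define n where "n f = (INF t\<in>{0..}. m (\<lambda>x. f x + t * g x) - t * m g)" for f
    have lower: "n f \<le> m (\<lambda>x. f x + t * g x) - t * m g" if f: "f \<in> U" and t: "0 \<le> t" for f t
      unfolding n_def
    proof (rule cINF_lower[OF bdd_belowI2])
      fix s :: real assume "s \<in> {0..}"
      \<comment> \<open>Subadditivity at \<open>s * g = (f + s * g) + (- f)\<close> bounds the
        family below by a constant independent of \<open>s\<close>.\<close>
      then have "m (\<lambda>x. s * g x) \<le> m (\<lambda>x. f x + s * g x) + m (\<lambda>x. - f x)"
        using sublinear_onD(1)[OF m, of "\<lambda>x. f x + s * g x" "\<lambda>x. - f x"] f g clos by simp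
      moreover have "s * m g \<le> m (\<lambda>x. s * g x)"
        using \<open>s \<in> {0..}\<close> sublinear_on_scale[OF U m _ g] by simp
      ultimately show "- m (\<lambda>x. - f x) \<le> m (\<lambda>x. f x + s * g x) - s * m g" by linarith
    qed (use t in auto)
    have greatest: "b \<le> n f" if "\<And>t. 0 \<le> t \<Longrightarrow> b \<le> m (\<lambda>x. f x + t * g x) - t * m g" for b f
      unfolding n_def using that by (intro cINF_greatest) auto
    have "sublinear_on U n"
      unfolding sublinear_on_def
    proof (intro conjI ballI allI impI)
      fix f h assume f: "f \<in> U" and h: "h \<in> U"
      have *: "n (\<lambda>x. f x + h x) \<le> (m (\<lambda>x. f x + s * g x) - s * m g) + (m (\<lambda>x. h x + t * g x) - t * m g)"
        if "0 \<le> s" "0 \<le> t" for s t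
      proof -
        have "n (\<lambda>x. f x + h x) \<le> m (\<lambda>x. f x + h x + (s + t) * g x) - (s + t) * m g"
          using that f h clos by (intro lower) auto
        also have "(\<lambda>x. f x + h x + (s + t) * g x) = (\<lambda>x. (f x + s * g x) + (h x + t * g x))"
          by (simp add: algebra_simps)
        also have "m \<dots> \<le> m (\<lambda>x. f x + s * g x) + m (\<lambda>x. h x + t * g x)"
          using f g h clos by (intro sublinear_onD(1)[OF m]) auto
        finally show ?thesis by (simp add: algebra_simps)
      qed
      have "n (\<lambda>x. f x + h x) - (m (\<lambda>x. h x + t * g x) - t * m g) \<le> n f" if "0 \<le> t" for t
        using *[OF _ that] by (intro greatest) (simp add: algebra_simps)
      then have "n (\<lambda>x. f x + h x) - n f \<le> n h"
        by (intro greatest) (simp add: algebra_simps)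
      then show "n (\<lambda>x. f x + h x) \<le> n f + n h" by simp
    next
      fix c :: real and f assume c: "0 \<le> c" and f: "f \<in> U"
      have *: "n (\<lambda>x. c * f x) \<le> c * (m (\<lambda>x. f x + t * g x) - t * m g)" if t: "0 \<le> t" for t
      proof -
        have "n (\<lambda>x. c * f x) \<le> m (\<lambda>x. c * f x + (c * t) * g x) - (c * t) * m g"
          using c t f clos by (intro lower) auto
        also have "(\<lambda>x. c * f x + (c * t) * g x) = (\<lambda>x. c * (f x + t * g x))"
          by (simp add: algebra_simps)
        also have "m \<dots> \<le> c * m (\<lambda>x. f x + t * g x)"
          using c f g clos by (intro sublinear_onD(2)[OF m]) auto
        finally show ?thesis by (simp add: algebra_simps)
      qed
      show "n (\<lambda>x. c * f x) \<le> c * n f"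
      proof (cases "c = 0")
        case True
        then show ?thesis using *[of 0] by simp
      next
        case False
        then have "n (\<lambda>x. c * f x) / c \<le> n f"
          using * c by (intro greatest) (simp add: field_simps)
        then show ?thesis using c False by (simp add: field_simps)
      qed
    qed
    \<comment> \<open>The parameter 0 puts \<open>n\<close> below \<open>m\<close>, so they agree by
      minimality; the parameter 1 then gives superadditivity.\<close>
    moreover have "n f \<le> m f" if "f \<in> U" for f using lower[OF that, of 0] by simp
    ultimately have "n f = m f" using f0 by (rule min)
    then show ?thesis using lower[OF f0, of 1] by simp
  qed
  have add: "m (\<lambda>x. f x + g x) = m f + m g" if "f \<in> U" "g \<in> U" for f g
    using super[OF that(2,1)] sublinear_onD(1)[OF m that] by simp
  have minus: "m (\<lambda>x. - f x) = - m f" if "f \<in> U" for f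
    using add[OF that clos(3)[OF that]] sublinear_on_zero[OF U m that] by simp
  have "m (\<lambda>x. c * f x) = c * m f" if f: "f \<in> U" for c f
  proof (cases "0 \<le> c")
    case True
    then show ?thesis using sublinear_on_scale[OF U m _ f] by blast
  next
    case False
    then show ?thesis using sublinear_on_scale[OF U m _ f, of "-c"] minus[OF clos(2)[OF f, of c]] f by simp
  qed
  with add le show ?thesis by blast
qed

section \<open>Positive normalized functionals as integrals\<close>

text \<open>Values off \<open>V\<close> are left free, so that members of \<open>H\<close> can be
  used as they stand; by \<open>mean.cong\<close> a mean ignores these values.\<close>

definition bounded_functions :: "'a set \<Rightarrow> ('a \<Rightarrow> real) set" where
  "bounded_functions V = {f. \<exists>b. \<forall>v\<in>V. \<bar>f v\<bar> \<le> b}"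

lemma function_space_bounded_functions: "function_space (bounded_functions V)"
  unfolding function_space_def
proof (intro conjI ballI allI)
  fix f g assume "f \<in> bounded_functions V" "g \<in> bounded_functions V"
  then obtain a b where "\<And>v. v \<in> V \<Longrightarrow> \<bar>f v\<bar> \<le> a" "\<And>v. v \<in> V \<Longrightarrow> \<bar>g v\<bar> \<le> b"
    unfolding bounded_functions_def by blast
  then have "\<And>v. v \<in> V \<Longrightarrow> \<bar>f v + g v\<bar> \<le> a + b" by (meson abs_triangle_ineq add_mono order_trans)
  then show "(\<lambda>x. f x + g x) \<in> bounded_functions V"
    unfolding bounded_functions_def by blast
next
  fix c :: real and f assume "f \<in> bounded_functions V"
  then obtain a where "\<And>v. v \<in> V \<Longrightarrow> \<bar>f v\<bar> \<le> a"
    unfolding bounded_functions_def by blast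
  then have "\<And>v. v \<in> V \<Longrightarrow> \<bar>c * f v\<bar> \<le> \<bar>c\<bar> * a" by (simp add: abs_mult mult_left_mono)
  then show "(\<lambda>x. c * f x) \<in> bounded_functions V"
    unfolding bounded_functions_def by blast
qed

text \<open>The condition \<open>le\<close> combines positivity, from \<open>a = 0\<close>, with
  normalization, from constant functions.\<close>

locale mean =
  fixes V :: "'a set" and l :: "('a \<Rightarrow> real) \<Rightarrow> real"
  assumes add: "f \<in> bounded_functions V \<Longrightarrow> g \<in> bounded_functions V \<Longrightarrow> l (\<lambda>x. f x + g x) = l f + l g"
    and scale: "f \<in> bounded_functions V \<Longrightarrow> l (\<lambda>x. c * f x) = c * l f"
    and le: "f \<in> bounded_functions V \<Longrightarrow> (\<And>v. v \<in> V \<Longrightarrow> f v \<le> a) \<Longrightarrow> l f \<le> a"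
begin

lemmas clos = function_spaceD[OF function_space_bounded_functions[of V]]

lemma const_in: "(\<lambda>x. c) \<in> bounded_functions V"
  unfolding bounded_functions_def by blast

lemma indicator_in: "indicator A \<in> bounded_functions V"
  unfolding bounded_functions_def by (auto intro!: exI[of _ 1] simp: indicator_def)

lemma diff: "f \<in> bounded_functions V \<Longrightarrow> g \<in> bounded_functions V \<Longrightarrow> l (\<lambda>x. f x - g x) = l f - l g"
  using add[of f "\<lambda>x. (-1) * g x"] scale[of g "-1"] clos(2)[of g "-1"] by simp

lemma diff_in: "f \<in> bounded_functions V \<Longrightarrow> g \<in> bounded_functions V \<Longrightarrow> (\<lambda>x. f x - g x) \<in> bounded_functions V"
  using clos(1)[of f "\<lambda>x. - g x"] clos(3)[of g] by simp

lemma mono: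
  assumes "f \<in> bounded_functions V" "g \<in> bounded_functions V" "\<And>v. v \<in> V \<Longrightarrow> f v \<le> g v"
  shows "l f \<le> l g"
  using le[OF diff_in[OF assms(1,2)], of 0] diff[OF assms(1,2)] assms(3) by simp

lemma cong:
  assumes "f \<in> bounded_functions V" "g \<in> bounded_functions V" "\<And>v. v \<in> V \<Longrightarrow> f v = g v"
  shows "l f = l g"
  using mono[OF assms(1,2)] mono[OF assms(2,1)] assms(3) by simp

lemma const: "l (\<lambda>x. c) = c"
  using le[OF const_in, of c c] le[OF const_in, of "-c" "-c"] scale[OF const_in, of "-1" c] by simp

lemma abs_diff_le:
  assumes "f \<in> bounded_functions V" "g \<in> bounded_functions V" "\<And>v. v \<in> V \<Longrightarrow> \<bar>f v - g v\<bar> \<le> a"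
  shows "\<bar>l f - l g\<bar> \<le> a"
proof -
  have "f v - g v \<le> a" "g v - f v \<le> a" if "v \<in> V" for v
    using assms(3)[OF that] by linarith+
  then show ?thesis
    using le[OF diff_in[OF assms(1,2)], of a] le[OF diff_in[OF assms(2,1)], of a]
    by (simp add: diff assms(1,2) abs_le_iff)
qed

lemma sum_scaled_indicator:
  assumes "finite Y"
  shows "(\<lambda>x. \<Sum>y\<in>Y. c y * indicator (B y) x) \<in> bounded_functions V"
    and "l (\<lambda>x. \<Sum>y\<in>Y. c y * indicator (B y) x) = (\<Sum>y\<in>Y. c y * l (indicator (B y)))"
proof -
  have "(\<lambda>x. \<Sum>y\<in>Y. c y * indicator (B y) x) \<in> bounded_functions V \<and>
    l (\<lambda>x. \<Sum>y\<in>Y. c y * indicator (B y) x) = (\<Sum>y\<in>Y. c y * l (indicator (B y)))"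
    using assms
  proof induction
    case empty
    then show ?case using const_in const by simp
  next
    case (insert y Y)
    have "(\<lambda>x. c y * indicator (B y) x) \<in> bounded_functions V" by (rule clos(2)[OF indicator_in])
    then show ?case
      unfolding sum.insert[OF insert.hyps]
      using insert.IH clos(1) add scale[OF indicator_in] by (simp del: sum_mult_indicator)
  qed
  then show "(\<lambda>x. \<Sum>y\<in>Y. c y * indicator (B y) x) \<in> bounded_functions V"
    and "l (\<lambda>x. \<Sum>y\<in>Y. c y * indicator (B y) x) = (\<Sum>y\<in>Y. c y * l (indicator (B y)))" by auto
qed

lemma finitely_additive_prob: "finitely_additive_prob V (Pow V) (\<lambda>A. l (indicator A))"
proof -
  have "l (indicator A) \<le> 1" for A
    by (rule le[OF indicator_in]) (simp add: indicator_def)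
  moreover have "l (indicator V) = 1"
    using cong[OF indicator_in const_in, of V 1] const by simp
  ultimately have "(SUP A\<in>Pow V. ereal (l (indicator A))) = 1"
    by (intro antisym SUP_least SUP_upper2[of V]) auto
  moreover have "0 \<le> l (indicator A)" for A
    using mono[OF const_in indicator_in, of 0 A] const[of 0] by simp
  moreover have "l (indicator (A \<union> B)) = l (indicator A) + l (indicator B)" if "A \<inter> B = {}" for A B
  proof -
    have "indicator (A \<union> B) = (\<lambda>x. indicator A x + indicator B x :: real)"
      using that by (intro ext) (auto simp: indicator_def)
    then show ?thesis by (simp add: add indicator_in)
  qed
  ultimately show ?thesis
    unfolding finitely_additive_prob_def finitely_additive_prob_axioms_def finitely_additive_def
      finitely_additive_axioms_def
    by (auto simp: additive_def ring_of_sets_iff)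
qed

text \<open>On \<open>V\<close>, \<open>X\<close> is the sum of its nonzero values times the
  indicators of their level sets, and \<open>l\<close> of this finite sum is the defining sum of the
  integral.\<close>

lemma simple_integral_eq:
  assumes fin: "finite (X ` V)"
  shows "X \<in> bounded_functions V" "simple_integral_fa V (\<lambda>A. l (indicator A)) X = l X"
proof -
  let ?Y = "X ` V - {0}"
  let ?X = "\<lambda>x. \<Sum>y\<in>?Y. y * indicator {x\<in>V. X x = y} x"
  have eq: "?X v = X v" if "v \<in> V" for v
  proof -
    have "?X v = (\<Sum>y\<in>?Y. if y = X v then X v else 0)"
      using that by (intro sum.cong) (auto simp: indicator_def)
    also have "\<dots> = X v" using fin that by auto
    finally show ?thesis .
  qed
  have "finite ?Y" using fin by simp
  note * = sum_scaled_indicator[OF this, of "\<lambda>y. y" "\<lambda>y. {x\<in>V. X x = y}"]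
  show X: "X \<in> bounded_functions V" using *(1) eq unfolding bounded_functions_def by simp
  show "simple_integral_fa V (\<lambda>A. l (indicator A)) X = l X"
    unfolding simple_integral_fa_def *(2)[symmetric] by (rule cong[OF *(1) X eq])
qed

text \<open>Rounding a bounded function down to multiples of \<open>1 / real (Suc n)\<close> leaves
  finitely many values and converges uniformly on \<open>V\<close>. Uniform closeness gives
  convergence with empty exceptional sets, the Cauchy property, and convergence of
  \<open>l (Xs n)\<close> to \<open>l f\<close>.\<close>

lemma representation:
  assumes f: "f \<in> bounded_functions V"
  shows "restrict f V \<in> L1_fa V (Pow V) (\<lambda>A. l (indicator A))"
    and "integral_fa V (Pow V) (\<lambda>A. l (indicator A)) (restrict f V) = l f"
proof -
  interpret finitely_additive_prob V "Pow V" "\<lambda>A. l (indicator A)"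
    by (rule finitely_additive_prob)
  obtain b where b: "\<And>v. v \<in> V \<Longrightarrow> \<bar>f v\<bar> \<le> b"
    using f unfolding bounded_functions_def by blast
  define Xs where "Xs n x = (if x \<in> V then of_int \<lfloor>real (Suc n) * f x\<rfloor> / real (Suc n) else 0)" for n x
  have close: "\<bar>Xs n v - f v\<bar> \<le> inverse (real (Suc n))" if "v \<in> V" for n v
  proof -
    have "Xs n v - f v = (of_int \<lfloor>real (Suc n) * f v\<rfloor> - real (Suc n) * f v) / real (Suc n)"
      using that by (simp add: Xs_def diff_divide_distrib del: of_nat_Suc)
    then have "\<bar>Xs n v - f v\<bar> = \<bar>of_int \<lfloor>real (Suc n) * f v\<rfloor> - real (Suc n) * f v\<bar> / real (Suc n)"
      by (simp add: abs_divide del: of_nat_Suc)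
    also have "\<dots> \<le> 1 / real (Suc n)"
      by (rule divide_right_mono) linarith+
    finally show ?thesis by (simp add: inverse_eq_divide)
  qed
  have fin: "finite (Xs n ` V)" for n
  proof (rule finite_subset)
    \<comment> \<open>The added 1 allows for rounding down, which can push the floor below
      \<open>- real (Suc n) * b\<close>.\<close>
    define K where "K = \<lceil>real (Suc n) * b\<rceil> + 1"
    show "Xs n ` V \<subseteq> (\<lambda>k. of_int k / real (Suc n)) ` {-K..K}"
    proof (rule image_subsetI)
      fix v assume v: "v \<in> V"
      have "\<bar>real (Suc n) * f v\<bar> \<le> real (Suc n) * b"
        using b[OF v] by (simp add: abs_mult del: of_nat_Suc)
      then have "\<lfloor>real (Suc n) * f v\<rfloor> \<in> {-K..K}" unfolding K_def atLeastAtMost_iff by linarith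
      then show "Xs n v \<in> (\<lambda>k. of_int k / real (Suc n)) ` {-K..K}" using v by (simp add: Xs_def)
    qed
  qed simp
  have simple: "simple (Xs n)" for n
    using fin unfolding simple_def by (auto simp: Xs_def)
  note [simp] = simple_integral_eq[OF fin]
  have approx: "approximates_fa V (Pow V) (\<lambda>A. l (indicator A)) Xs (restrict f V)"
    unfolding approximates_fa_def
  proof (intro conjI allI impI)
    show "Xs n \<in> simple_functions (Pow V)" for n
      using simple by (simp add: simple_functions_eq)
    show "converges_fa V (Pow V) (\<lambda>A. l (indicator A)) Xs (restrict f V)"
      unfolding converges_fa_iff
    proof (intro allI impI)
      fix c e :: real assume c: "0 < c" and e: "0 < e"
      have "\<forall>\<^sub>F n in sequentially. inverse (real (Suc n)) < c"
        using LIMSEQ_inverse_real_of_nat c by (rule order_tendstoD)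
      then show "\<forall>\<^sub>F n in sequentially. \<exists>E\<in>Pow V. l (indicator E) < e \<and>
          (\<forall>x\<in>V - E. \<bar>Xs n x - restrict f V x\<bar> \<le> c)"
      proof eventually_elim
        case (elim n)
        have "\<bar>Xs n x - restrict f V x\<bar> \<le> c" if "x \<in> V" for x
          using close[OF that, of n] elim that by simp
        then show ?case using e measure_empty by (intro bexI[of _ "{}"]) auto
      qed
    qed
    fix e :: real assume e: "0 < e"
    \<comment> \<open>From \<open>N\<close> on, all members are within \<open>e / 3\<close> of
      \<open>f\<close>, hence within \<open>2 * e / 3\<close> of each other, which leaves room for
      the strict inequality.\<close>
    then obtain N where N: "inverse (real (Suc N)) < e / 3"
      using reals_Archimedean[of "e/3"] by auto
    have close': "\<bar>Xs n v - f v\<bar> \<le> e/3" if "v \<in> V" "N \<le> n" for n v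
    proof -
      have "inverse (real (Suc n)) \<le> inverse (real (Suc N))" using that by (intro le_imp_inverse_le) auto
      then show ?thesis using close[OF that(1), of n] N by linarith
    qed
    show "\<exists>N. \<forall>m\<ge>N. \<forall>n\<ge>N. integral (\<lambda>x. \<bar>Xs n x - Xs m x\<bar>) < e"
    proof (intro exI allI impI)
      fix m n assume mn: "N \<le> m" "N \<le> n"
      have "finite ((\<lambda>x. \<bar>Xs n x - Xs m x\<bar>) ` V)"
        using simple_abs[OF simple_diff[OF simple simple]] by (simp add: simple_def)
      note * = simple_integral_eq[OF this]
      have "l (\<lambda>x. \<bar>Xs n x - Xs m x\<bar>) \<le> 2 * e / 3"
      proof (rule le[OF *(1)])
        fix v assume "v \<in> V"
        then show "\<bar>Xs n v - Xs m v\<bar> \<le> 2 * e / 3"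
          using close'[of v n] close'[of v m] mn by linarith
      qed
      also have "\<dots> < e" using e by simp
      finally show "integral (\<lambda>x. \<bar>Xs n x - Xs m x\<bar>) < e" using *(2) by simp
    qed
  qed
  have "(\<lambda>n. l (Xs n)) \<longlonglongrightarrow> l f"
  proof (rule LIM_zero_cancel, rule Lim_null_comparison)
    show "\<forall>\<^sub>F n in sequentially. norm (l (Xs n) - l f) \<le> inverse (real (Suc n))"
      using abs_diff_le[OF _ f close] by (intro always_eventually) simp
  qed (rule LIMSEQ_inverse_real_of_nat)
  then show "integral_fa V (Pow V) (\<lambda>A. l (indicator A)) (restrict f V) = l f"
    by (intro integral_fa_eqI[OF approx]) simp
  show "restrict f V \<in> L1_fa V (Pow V) (\<lambda>A. l (indicator A))"
    using approx by (auto simp: L1_fa_def)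
qed

end

section \<open>Extension of the functional to a mean\<close>

text \<open>The functional \<open>q\<close> is the infimum over \<open>h\<close> in \<open>H\<close>
  of \<open>\<phi> h\<close> plus the supremum over \<open>V\<close> of \<open>f - h\<close>. A
  linear minorant of \<open>q\<close> lies below \<open>\<phi>\<close> on \<open>H\<close>, and
  testing with \<open>- h\<close> forces equality; it also lies below every upper bound of
  \<open>f\<close> on \<open>V\<close>, so it is a mean.\<close>

lemma exists_mean_extension:
  assumes H: "function_subspace S H" and \<phi>: "linear_functional_on S H \<phi>" and V: "V \<subseteq> S"
    and bdd: "H \<subseteq> bounded_functions V"
    and le: "\<And>h a. h \<in> H \<Longrightarrow> (\<And>v. v \<in> V \<Longrightarrow> h v \<le> a) \<Longrightarrow> \<phi> h \<le> a"
  shows "\<exists>l. mean V l \<and> (\<forall>h\<in>H. l h = \<phi> h)"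
proof -
  let ?U = "bounded_functions V"
  note clos = function_spaceD[OF function_space_bounded_functions[of V]]
  have H_add: "(\<lambda>x\<in>S. f x + g x) \<in> H" "\<phi> (\<lambda>x\<in>S. f x + g x) = \<phi> f + \<phi> g" if "f \<in> H" "g \<in> H" for f g
    using H \<phi> that by (auto simp: function_subspace_def linear_functional_on_def)
  have H_scale: "(\<lambda>x\<in>S. c * f x) \<in> H" "\<phi> (\<lambda>x\<in>S. c * f x) = c * \<phi> f" if "f \<in> H" for f c
    using H \<phi> that by (auto simp: function_subspace_def linear_functional_on_def)
  have H_zero: "(\<lambda>x\<in>S. 0) \<in> H" using H by (simp add: function_subspace_def)
  have \<phi>_zero: "\<phi> (\<lambda>x\<in>S. 0) = 0" using H_scale(2)[OF H_zero, of 0] by simp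
  \<comment> \<open>The upper bounds for the value at \<open>f\<close> of any positive normalized extension of \<open>\<phi>\<close>.\<close>
  define T where "T f = {a. \<exists>h\<in>H. \<forall>v\<in>V. f v \<le> h v + (a - \<phi> h)}" for f
  define q where "q f = Inf (T f)" for f
  have T_const: "a \<in> T f" if "\<And>v. v \<in> V \<Longrightarrow> f v \<le> a" for f a
    unfolding T_def using that H_zero \<phi>_zero V by (auto intro!: bexI[of _ "\<lambda>x\<in>S. 0"] simp: subset_iff)
  have T_H: "\<phi> h \<in> T h" if "h \<in> H" for h
    unfolding T_def using that by (auto intro!: bexI[of _ h])
  have T_ne: "T f \<noteq> {}" if f: "f \<in> ?U" for f
  proof -
    obtain b where "\<And>v. v \<in> V \<Longrightarrow> \<bar>f v\<bar> \<le> b" using f unfolding bounded_functions_def by blast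
    then have "b \<in> T f" by (intro T_const) (meson abs_le_D1)
    then show ?thesis by blast
  qed
  have T_bdd: "bdd_below (T f)" if f: "f \<in> ?U" for f
  proof -
    obtain b where b: "\<And>v. v \<in> V \<Longrightarrow> \<bar>f v\<bar> \<le> b" using f unfolding bounded_functions_def by blast
    show ?thesis
    proof (rule bdd_belowI)
      fix a assume "a \<in> T f"
      then obtain h where h: "h \<in> H" "\<And>v. v \<in> V \<Longrightarrow> f v \<le> h v + (a - \<phi> h)" by (auto simp: T_def)
      \<comment> \<open>Since \<open>f \<ge> - b\<close> on \<open>V\<close>, the negative of
        \<open>h\<close> is at most \<open>a - \<phi> h + b\<close> there; after applying
        \<open>\<phi>\<close>, the terms \<open>\<phi> h\<close> cancel.\<close>
      have "\<phi> (\<lambda>x\<in>S. (-1) * h x) \<le> a - \<phi> h + b"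
      proof (rule le[OF H_scale(1)[OF h(1)]])
        fix v assume v: "v \<in> V"
        then show "(\<lambda>x\<in>S. (-1) * h x) v \<le> a - \<phi> h + b" using h(2)[OF v] b[OF v] V by auto
      qed
      then show "- b \<le> a" using H_scale(2)[OF h(1), of "-1"] by simp
    qed
  qed
  have q_le: "q f \<le> a" if "f \<in> ?U" "a \<in> T f" for f a
    unfolding q_def using that T_bdd by (intro cInf_lower)
  have q_ge: "b \<le> q f" if "f \<in> ?U" "\<And>a. a \<in> T f \<Longrightarrow> b \<le> a" for f b
    unfolding q_def using that T_ne by (intro cInf_greatest)
  have "sublinear_on ?U q"
    unfolding sublinear_on_def
  proof (intro conjI ballI allI impI)
    fix f g assume f: "f \<in> ?U" and g: "g \<in> ?U"
    have *: "q (\<lambda>x. f x + g x) \<le> a + b" if "a \<in> T f" "b \<in> T g" for a b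
    proof (rule q_le[OF clos(1)[OF f g]])
      obtain h k where h: "h \<in> H" "\<forall>v\<in>V. f v \<le> h v + (a - \<phi> h)"
        and k: "k \<in> H" "\<forall>v\<in>V. g v \<le> k v + (b - \<phi> k)"
        using \<open>a \<in> T f\<close> \<open>b \<in> T g\<close> by (auto simp: T_def)
      have "\<forall>v\<in>V. f v + g v \<le> (\<lambda>x\<in>S. h x + k x) v + (a + b - \<phi> (\<lambda>x\<in>S. h x + k x))"
      proof
        fix v assume v: "v \<in> V"
        then have "v \<in> S" using V by blast
        then show "f v + g v \<le> (\<lambda>x\<in>S. h x + k x) v + (a + b - \<phi> (\<lambda>x\<in>S. h x + k x))"
          using h(2)[rule_format, OF v] k(2)[rule_format, OF v] H_add(2)[OF h(1) k(1)] by simp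
      qed
      then show "a + b \<in> T (\<lambda>x. f x + g x)"
        unfolding T_def using H_add(1)[OF h(1) k(1)] by blast
    qed
    have "q (\<lambda>x. f x + g x) - b \<le> q f" if "b \<in> T g" for b
      using *[OF _ that] by (intro q_ge[OF f]) (simp add: algebra_simps)
    then have "q (\<lambda>x. f x + g x) - q f \<le> q g"
      by (intro q_ge[OF g]) (simp add: algebra_simps)
    then show "q (\<lambda>x. f x + g x) \<le> q f + q g" by simp
  next
    fix c :: real and f assume c: "0 \<le> c" and f: "f \<in> ?U"
    have *: "q (\<lambda>x. c * f x) \<le> c * a" if "a \<in> T f" for a
    proof (rule q_le[OF clos(2)[OF f]])
      obtain h where h: "h \<in> H" "\<forall>v\<in>V. f v \<le> h v + (a - \<phi> h)"
        using \<open>a \<in> T f\<close> by (auto simp: T_def)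
      have "\<forall>v\<in>V. c * f v \<le> (\<lambda>x\<in>S. c * h x) v + (c * a - \<phi> (\<lambda>x\<in>S. c * h x))"
      proof
        fix v assume v: "v \<in> V"
        then have "v \<in> S" using V by blast
        then show "c * f v \<le> (\<lambda>x\<in>S. c * h x) v + (c * a - \<phi> (\<lambda>x\<in>S. c * h x))"
          using mult_left_mono[OF h(2)[rule_format, OF v] c] H_scale(2)[OF h(1), of c]
          by (simp add: algebra_simps)
      qed
      then show "c * a \<in> T (\<lambda>x. c * f x)"
        unfolding T_def using H_scale(1)[OF h(1)] by blast
    qed
    show "q (\<lambda>x. c * f x) \<le> c * q f"
    proof (cases "c = 0")
      case True
      then show ?thesis using * T_ne[OF f] by auto
    next
      case False
      then have "q (\<lambda>x. c * f x) / c \<le> q f"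
        using * c by (intro q_ge[OF f]) (simp add: field_simps)
      then show ?thesis using c False by (simp add: field_simps)
    qed
  qed
  from exists_linear_minorant[OF function_space_bounded_functions this] obtain l where
    l: "\<forall>f\<in>?U. \<forall>g\<in>?U. l (\<lambda>x. f x + g x) = l f + l g"
      "\<forall>c. \<forall>f\<in>?U. l (\<lambda>x. c * f x) = c * l f" "\<forall>f\<in>?U. l f \<le> q f"
    by blast
  have l_le: "l f \<le> a" if "f \<in> ?U" "a \<in> T f" for f a
    using l(3) q_le[OF that] that(1) by force
  interpret mean V l
    by unfold_locales (use l(1,2) l_le T_const in auto)
  have "l h = \<phi> h" if h: "h \<in> H" for h
  proof (rule antisym)
    have U: "h \<in> ?U" "(\<lambda>x\<in>S. (-1) * h x) \<in> ?U" using bdd h H_scale(1)[OF h] by blast+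
    show "l h \<le> \<phi> h" by (rule l_le[OF U(1) T_H[OF h]])
    \<comment> \<open>Multiples formed in \<open>H\<close> are undefined off \<open>S\<close>, but
      on \<open>V\<close> they agree with the plain pointwise ones.\<close>
    have "l (\<lambda>x\<in>S. (-1) * h x) = l (\<lambda>x. (-1) * h x)"
      using V by (intro cong[OF U(2) clos(2)[OF U(1)]]) auto
    also have "\<dots> = - l h" using scale[OF U(1), of "-1"] by simp
    finally show "\<phi> h \<le> l h"
      using l_le[OF U(2) T_H[OF H_scale(1)[OF h]]] H_scale(2)[OF h, of "-1"] by simp
  qed
  then show ?thesis using mean_axioms by blast
qed

section \<open>Lower bounds by the infimum and representation by a probability structure\<close>

theorem corollary3:
  fixes S V :: "'s set"
    and H :: "('s \<Rightarrow> real) set"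
    and \<phi> :: "('s \<Rightarrow> real) \<Rightarrow> real"
  assumes "function_subspace S H"
    and "linear_functional_on S H \<phi>"
    and "V \<subseteq> S"
    and "bounded_on_family H V"
  shows "(\<forall>h\<in>H. ereal (\<phi> h) \<ge> (INF v\<in>V. ereal (h v))) \<longleftrightarrow>
    (\<exists>\<R> \<mu>. probability_structure V \<R> \<mu> \<and>
       (\<forall>h\<in>H. restrict h V \<in> L1_fa V \<R> \<mu> \<and> \<phi> h = integral_fa V \<R> \<mu> (restrict h V)))"
    (is "?L \<longleftrightarrow> ?R")
proof
  have bdd: "h \<in> bounded_functions V" if "h \<in> H" for h
  proof -
    have "(SUP v\<in>V. ereal \<bar>h v\<bar>) < \<infinity>" using assms(4) that by (auto simp: bounded_on_family_def)
    then obtain b where "(SUP v\<in>V. ereal \<bar>h v\<bar>) < ereal b" using less_PInf_Ex_of_nat by auto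
    then have "\<bar>h v\<bar> \<le> b" if "v \<in> V" for v
      using SUP_upper[OF that, of "\<lambda>v. ereal \<bar>h v\<bar>"] by (metis ereal_less_eq(3) less_imp_le order_trans)
    then show ?thesis unfolding bounded_functions_def by blast
  qed
  {
    assume L: ?L
    \<comment> \<open>The lower bound at the negative of \<open>h\<close> becomes the upper bound at
      \<open>h\<close> that the extension requires.\<close>
    have "\<phi> h \<le> a" if h: "h \<in> H" and a: "\<And>v. v \<in> V \<Longrightarrow> h v \<le> a" for h a
    proof -
      have h': "(\<lambda>x\<in>S. (-1) * h x) \<in> H" "\<phi> (\<lambda>x\<in>S. (-1) * h x) = (-1) * \<phi> h"
        using assms(1,2) h unfolding function_subspace_def linear_functional_on_def by blast+
      have "ereal (- a) \<le> (INF v\<in>V. ereal ((\<lambda>x\<in>S. (-1) * h x) v))"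
        using a assms(3) by (intro INF_greatest) auto
      also have "\<dots> \<le> ereal (- \<phi> h)" using L[rule_format, OF h'(1)] h'(2) by simp
      finally show ?thesis by simp
    qed
    then obtain l where l: "mean V l" "\<forall>h\<in>H. l h = \<phi> h"
      using exists_mean_extension[OF assms(1-3)] bdd by blast
    interpret mean V l by (rule l(1))
    show ?R
      using finitely_additive_prob representation bdd l(2)
      unfolding finitely_additive_prob_iff by metis
  }
  assume ?R
  then obtain \<R> \<mu> where prob: "probability_structure V \<R> \<mu>"
    and rep: "\<And>h. h \<in> H \<Longrightarrow> restrict h V \<in> L1_fa V \<R> \<mu>"
      "\<And>h. h \<in> H \<Longrightarrow> \<phi> h = integral_fa V \<R> \<mu> (restrict h V)" by blast
  interpret finitely_additive_prob V \<R> \<mu>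
    using prob by (simp add: finitely_additive_prob_iff)
  show ?L
  proof
    fix h assume h: "h \<in> H"
    show "(INF v\<in>V. ereal (h v)) \<le> ereal (\<phi> h)"
    proof (rule ccontr)
      assume "\<not> ?thesis"
      \<comment> \<open>A real threshold strictly between the two sides spares a case distinction on
        whether the extended infimum is finite.\<close>
      then obtain a where a: "ereal (\<phi> h) < ereal a" "ereal a < (INF v\<in>V. ereal (h v))"
        using ereal_dense2 by (metis not_le)
      have "a \<le> h v" if "v \<in> V" for v
        using less_INF_D[OF a(2) that] by simp
      then have "a \<le> \<phi> h"
        using integral_fa_ge[OF rep(1)[OF h], of a] rep(2)[OF h] by simp
      with a(1) show False by simp
    qed
  qed
qed

end
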